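(* Let $D=\{(t,s,x): 0<s<t<\infty,\ |x|<\infty\}$. Let $K(t,s,x)$ be defined, continuous, and differentiable with respect to $x$ in $D$, and suppose there are functions $m$ and $\gamma$ as described in the context (continuous, positive, monotonically increasing, with $\gamma$ differentiable and convex and $\gamma(0)\neq 0$) such that in $D$ $$|K(t,s,x)|\le m(s)\gamma(|x|),\qquad \left|\frac{\partial K}{\partial x}(t,s,x)\right|\le m(s)\gamma'(|x|).$$ Suppose that $\lim_{x\to+\infty}\int_0^x\frac{d\xi}{\gamma(\xi)}=+\infty$. Then the integral equation $$x(t)=\int_0^t K(t,s,x(s))\,ds,\qquad x(0)=0,$$ has a Kantorovich main solution $x(t)$ defined for $t\in[0,\infty)$, and the a priori estimate $|x(t)|\le\hat x(t)$ holds for $t\in[0,\infty)$, where $\hat x(t)$ is the solution of the Cauchy problem $$\frac{d\hat x}{dt}=m(t)\gamma(\hat x(t)),\qquad \hat x(0)=0.$$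
   Context: Functions $m(s)$ and $\gamma(x)$: $m$ is defined, continuous, positive and monotonically increasing for $0<s<\infty$, and is extended to $s=0$ by its limit; $\gamma$ is defined, continuous, positive and monotonically increasing for $0<x<\infty$, extended to $x=0$ by its limit, differentiable on $[0,\infty)$ (one-sided at $0$), and convex, with $\gamma(0)\neq 0$. Kantorovich main solution: a continuous function $x(t)$ satisfying the equation $x(t)=\int_0^tK(t,s,x(s))\,ds$ on an interval is called a Kantorovich main solution on that interval if the sequence $x_n(t)=\int_0^t K(t,s,x_{n-1}(s))\,ds$, $x_0(t)\equiv 0$, converges to $x(t)$ for every $t$ in the interval. *)

theory Defs
  imports "HOL-Analysis.Analysis"
begin

definition kernel_domain :: "(real \<times> real \<times> real) set" where
  "kernel_domain = {(t, s, x). 0 < s \<and> s < t}"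

definition increasing_factor :: "(real \<Rightarrow> real) \<Rightarrow> bool" where
  "increasing_factor f \<longleftrightarrow>
     continuous_on {0<..} f \<and> (\<forall>s>0. 0 < f s) \<and> mono_on {0<..} f \<and>
     (f \<longlongrightarrow> f 0) (at_right 0)"

text \<open>
  The kernel is a total function, but the integrals below see its values only for
  \<open>0 < s < t\<close>, since the end points of \<open>{0..t}\<close> form a null set.
\<close>

primrec picard :: "(real \<Rightarrow> real \<Rightarrow> real \<Rightarrow> real) \<Rightarrow> nat \<Rightarrow> real \<Rightarrow> real" where
  "picard K 0 = (\<lambda>t. 0)"
| "picard K (Suc n) = (\<lambda>t. integral {0..t} (\<lambda>s. K t s (picard K n s)))"

text \<open>
  Integrability of every iterate is required explicitly, because \<open>integral\<close> returns 0
  on functions that are not integrable.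
\<close>

definition kantorovich_main_solution ::
    "(real \<Rightarrow> real \<Rightarrow> real \<Rightarrow> real) \<Rightarrow> real set \<Rightarrow> (real \<Rightarrow> real) \<Rightarrow> bool" where
  "kantorovich_main_solution K I x \<longleftrightarrow>
     continuous_on I x \<and>
     (\<forall>t\<in>I. ((\<lambda>s. K t s (x s)) has_integral x t) {0..t}) \<and>
     (\<forall>n. \<forall>t\<in>I. (\<lambda>s. K t s (picard K n s)) integrable_on {0..t}) \<and>
     (\<forall>t\<in>I. (\<lambda>n. picard K n t) \<longlonglongrightarrow> x t)"

text \<open>
  The function \<open>\<gamma>\<close> is meaningful only on \<open>[0, \<infinity>)\<close>, so a solution of the Cauchy problem has
  to take its values there.
\<close>

definition cauchy_solution :: "(real \<Rightarrow> real) \<Rightarrow> (real \<Rightarrow> real) \<Rightarrow> (real \<Rightarrow> real) \<Rightarrow> bool" where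
  "cauchy_solution m \<gamma> y \<longleftrightarrow>
     y 0 = 0 \<and>
     (\<forall>t\<ge>0. 0 \<le> y t \<and> (y has_real_derivative m t * \<gamma> (y t)) (at t within {0..}))"

end

theory Submission
  imports Defs
begin

text \<open>
  The majorant \<open>y\<close> with \<open>y' = m \<gamma>(y)\<close> exists globally by separation of variables, because the
  primitive of \<open>1 / \<gamma>\<close> is unbounded. The growth condition on \<open>K\<close> keeps every Picard iterate
  below \<open>y\<close>. On \<open>[0, T]\<close> all iterates therefore live in \<open>[-y(T), y(T)]\<close>, where \<open>K\<close> is Lipschitz
  in \<open>x\<close> with a single constant, since \<open>\<gamma>' \<le> \<gamma>(y(T) + 1)\<close> there by convexity. So consecutive
  iterates differ by at most the terms of an exponential series and converge uniformly on \<open>[0, T]\<close>.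
\<close>

text \<open>Only the weak inequality survives at 0: the value there is a limit of positive numbers
  and may vanish, as for \<open>f s = s\<close>.\<close>

lemma increasing_factor_nonneg:
  assumes "increasing_factor f" "0 \<le> s"
  shows "0 \<le> f s"
proof (cases "s = 0")
  case True
  have "(f \<longlongrightarrow> f 0) (at_right 0)"
    using assms by (simp add: increasing_factor_def)
  moreover have "\<forall>\<^sub>F x in at_right 0. 0 \<le> f x"
    using assms by (auto simp: increasing_factor_def eventually_at_filter less_imp_le)
  ultimately have "0 \<le> f 0"
    by (intro tendsto_lowerbound) auto
  then show ?thesis using True by simp
qed (use assms in \<open>auto simp: increasing_factor_def less_imp_le\<close>)

lemma increasing_factor_continuous_on:
  assumes "increasing_factor f"
  shows "continuous_on {0..} f"
  unfolding continuous_on_def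
proof
  fix x :: real assume x: "x \<in> {0..}"
  show "(f \<longlongrightarrow> f x) (at x within {0..})"
  proof (cases "x = 0")
    case True
    then show ?thesis
      using assms by (simp add: increasing_factor_def at_within_Ici_at_right)
  next
    case False
    with x have "isCont f x"
      using assms by (auto simp: increasing_factor_def continuous_on_eq_continuous_at)
    then show ?thesis
      unfolding isCont_def by (rule tendsto_within_subset) simp
  qed
qed

lemma increasing_factor_mono_on:
  assumes "increasing_factor f"
  shows "mono_on {0..} f"
proof (rule mono_onI)
  fix r s :: real assume rs: "r \<in> {0..}" "s \<in> {0..}" "r \<le> s"
  have mono: "mono_on {0<..} f" and lim: "(f \<longlongrightarrow> f 0) (at_right 0)"
    using assms by (auto simp: increasing_factor_def)
  \<comment> \<open>The case reaching beyond \<open>{0<..}\<close> is \<open>r = 0 < s\<close>: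
    there \<open>f x \<le> f s\<close> for small positive \<open>x\<close> passes to the
    limit.\<close>
  show "f r \<le> f s"
  proof (cases "r = 0 \<and> s > 0")
    case True
    have "\<forall>\<^sub>F x in at_right 0. f x \<le> f s"
      using eventually_at_right_less[of 0] order_tendstoD(2)[OF tendsto_ident_at, of 0 s "{0<..}"] True
      by (auto elim!: eventually_elim2 intro!: mono_onD[OF mono])
    then show ?thesis
      using True lim by (auto intro: tendsto_upperbound)
  next
    case False
    then show ?thesis
      using rs by (cases "r = s") (auto intro!: mono_onD[OF mono])
  qed
qed

text \<open>The derivative is two-sided also at 0, as the inverse function rule for the primitive of
  \<open>1 / \<gamma>\<close> requires. The normalisation at 0 carries the initial condition of the
  Cauchy problem.\<close>

lemma antiderivative_from_0:
  fixes f :: "real \<Rightarrow> real"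
  assumes "continuous_on UNIV f"
  obtains F where "F 0 = 0" "\<And>x. (F has_real_derivative f x) (at x)"
proof -
  have "\<exists>F. \<forall>x::real. -\<infinity> < ereal x \<longrightarrow> ereal x < \<infinity> \<longrightarrow> (F has_vector_derivative f x) (at x)"
    using assms by (intro einterval_antiderivative) (auto simp: continuous_on_eq_continuous_at)
  then obtain F where F: "\<And>x. (F has_real_derivative f x) (at x)"
    by (auto simp: has_real_derivative_iff_has_vector_derivative)
  show thesis
    by (rule that[of "\<lambda>x. F x - F 0"]) (auto intro!: derivative_eq_intros F)
qed

lemma cauchy_solution_has_integral:
  assumes "cauchy_solution m \<gamma> y" "0 \<le> t"
  shows "((\<lambda>s. m s * \<gamma> (y s)) has_integral y t) {0..t}"
proof -
  have "((\<lambda>s. m s * \<gamma> (y s)) has_integral y t - y 0) {0..t}"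
    using assms
    by (intro fundamental_theorem_of_calculus)
       (auto simp: cauchy_solution_def has_real_derivative_iff_has_vector_derivative[symmetric]
             intro: DERIV_subset)
  then show ?thesis
    using assms by (simp add: cauchy_solution_def)
qed

text \<open>Separation of variables: both factors are extended evenly to the whole line, so that the
  solution is a composition of functions differentiable on both sides of 0.\<close>

lemma cauchy_solution_unique_existence:
  assumes m: "increasing_factor m" and \<gamma>: "increasing_factor \<gamma>" and \<gamma>_0: "\<gamma> 0 \<noteq> 0"
    and diverges: "filterlim (\<lambda>x. integral {0..x} (\<lambda>\<xi>. 1 / \<gamma> \<xi>)) at_top at_top"
  obtains y where "cauchy_solution m \<gamma> y"
    "\<And>z t. cauchy_solution m \<gamma> z \<Longrightarrow> 0 \<le> t \<Longrightarrow> z t = y t"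
proof -
  \<comment> \<open>\<open>\<gamma> 0 \<noteq> 0\<close> excludes a vanishing limit at 0, so
    \<open>1 / \<gamma>\<close> is continuous up to 0.\<close>
  have pos: "0 < \<gamma> x" if "0 \<le> x" for x
    using that \<gamma> \<gamma>_0 increasing_factor_nonneg[OF \<gamma>, of 0]
    by (cases "x = 0") (auto simp: increasing_factor_def)
  have "continuous_on UNIV (\<lambda>x. \<gamma> \<bar>x\<bar>)" and m_abs: "continuous_on UNIV (\<lambda>x. m \<bar>x\<bar>)"
    by (rule continuous_on_compose2[OF increasing_factor_continuous_on];
        auto intro!: continuous_intros m \<gamma>)+
  then have "continuous_on UNIV (\<lambda>x. 1 / \<gamma> \<bar>x\<bar>)"
    by (intro continuous_intros) (auto simp: pos less_imp_neq[symmetric])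
  then obtain \<Phi> where \<Phi>0: "\<Phi> 0 = 0"
    and d\<Phi>: "\<And>x. (\<Phi> has_real_derivative 1 / \<gamma> \<bar>x\<bar>) (at x)"
    using antiderivative_from_0 by blast
  obtain M where M0: "M 0 = 0" and dM: "\<And>x. (M has_real_derivative m \<bar>x\<bar>) (at x)"
    using antiderivative_from_0[OF m_abs] by blast
  have \<Phi>_mono: "\<Phi> a < \<Phi> b" if "a < b" for a b
    by (rule DERIV_pos_imp_increasing[OF that]) (use d\<Phi> pos in force)
  have \<Phi>_cont: "isCont \<Phi> x" for x
    by (rule DERIV_isCont[OF d\<Phi>])
  \<comment> \<open>The integrand is even, so its primitive from 0 is odd; this carries surjectivity
    over from nonnegative to negative values.\<close>
  have \<Phi>_odd: "\<Phi> (- x) = - \<Phi> x" for x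
  proof -
    have "((\<lambda>x. \<Phi> x + \<Phi> (- x)) has_real_derivative 0) (at x)" for x
      using DERIV_add[OF d\<Phi>[of x] DERIV_chain2[OF d\<Phi>, of uminus "-1" x]]
      by (simp add: DERIV_minus DERIV_ident)
    then have "\<Phi> x + \<Phi> (- x) = \<Phi> 0 + \<Phi> (- 0)"
      by (rule DERIV_isconst_all[rule_format, of "\<lambda>x. \<Phi> x + \<Phi> (- x)"])
    then show ?thesis by (simp add: \<Phi>0)
  qed
  have \<Phi>_integral: "\<Phi> x = integral {0..x} (\<lambda>\<xi>. 1 / \<gamma> \<xi>)" if "0 \<le> x" for x
  proof -
    have "((\<lambda>\<xi>. 1 / \<gamma> \<bar>\<xi>\<bar>) has_integral \<Phi> x - \<Phi> 0) {0..x}"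
      using has_field_derivative_at_within[OF d\<Phi>] that
      by (intro fundamental_theorem_of_calculus)
         (simp_all only: has_real_derivative_iff_has_vector_derivative)
    then have "((\<lambda>\<xi>. 1 / \<gamma> \<xi>) has_integral \<Phi> x - \<Phi> 0) {0..x}"
      by (rule has_integral_eq[rotated]) auto
    then show ?thesis by (simp add: integral_unique \<Phi>0)
  qed
  \<comment> \<open>Divergence of the integral enters here: \<open>\<Phi>\<close> is unbounded
    above, so the intermediate value theorem reaches every \<open>v\<close> and the majorant never
    blows up.\<close>
  have surj_nonneg: "\<exists>x. \<Phi> x = v" if "0 \<le> v" for v
  proof -
    have "\<forall>\<^sub>F x in at_top. v \<le> integral {0..x} (\<lambda>\<xi>. 1 / \<gamma> \<xi>)"
      using diverges by (simp add: filterlim_at_top)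
    then have "\<forall>\<^sub>F x in at_top. 0 \<le> x \<and> v \<le> \<Phi> x"
      using eventually_ge_at_top[of 0] by eventually_elim (simp add: \<Phi>_integral)
    then obtain b where "0 \<le> b" "v \<le> \<Phi> b"
      using eventually_happens by fastforce
    then show ?thesis
      using IVT[of \<Phi> 0 v b] \<Phi>_cont \<Phi>0 that by auto
  qed
  have surj: "\<exists>x. \<Phi> x = v" for v
    by (metis surj_nonneg \<Phi>_odd linear minus_minus neg_0_le_iff_le)
  \<comment> \<open>Choice gives a right inverse of \<open>\<Phi>\<close>; strict monotonicity makes
    it two-sided.\<close>
  define G where "G v = (SOME x. \<Phi> x = v)" for v
  have \<Phi>G: "\<Phi> (G v) = v" for v
    unfolding G_def using someI_ex[OF surj] .
  have inj: "a = b" if "\<Phi> a = \<Phi> b" for a b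
    using that \<Phi>_mono[of a b] \<Phi>_mono[of b a] by (cases a b rule: linorder_cases) auto
  have G\<Phi>: "G (\<Phi> x) = x" for x
    using \<Phi>G inj by blast
  have G_cont: "isCont G v" for v
    using isCont_inverse_function[of 1 "G v" G \<Phi>] G\<Phi> \<Phi>G \<Phi>_cont by simp
  have dG: "(G has_real_derivative \<gamma> \<bar>G v\<bar>) (at v)" for v
    using DERIV_inverse_function[OF d\<Phi>, of G v "v - 1" "v + 1"] \<Phi>G G_cont pos[of "\<bar>G v\<bar>"] by simp
  define y where "y t = G (M t)" for t
  have M_nonneg: "0 \<le> M t" if "0 \<le> t" for t
    using DERIV_nonneg_imp_nondecreasing[OF that, of M] dM increasing_factor_nonneg[OF m] M0
    by (metis abs_ge_zero)
  \<comment> \<open>A negative \<open>y t\<close> would give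
    \<open>\<Phi> (y t) < \<Phi> 0 = 0\<close>, contradicting
    \<open>\<Phi> (y t) = M t \<ge> 0\<close>. Hence the even extension of \<open>\<gamma>\<close>
    agrees with \<open>\<gamma>\<close> along \<open>y\<close>.\<close>
  have y_nonneg: "0 \<le> y t" if "0 \<le> t" for t
    using M_nonneg[OF that] \<Phi>_mono[of "y t" 0] \<Phi>G[of "M t"] \<Phi>0 unfolding y_def by force
  have dy: "(y has_real_derivative m t * \<gamma> (y t)) (at t within {0..})" if "0 \<le> t" for t
    using DERIV_chain2[OF dG dM, of t] that y_nonneg[OF that]
    by (auto simp: y_def[abs_def] mult.commute intro: has_field_derivative_at_within)
  have "y 0 = 0"
    using \<Phi>G[of 0] inj \<Phi>0 M0 by (simp add: y_def)
  then have "cauchy_solution m \<gamma> y"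
    using dy y_nonneg by (auto simp: cauchy_solution_def)
  moreover have "z t = y t" if z: "cauchy_solution m \<gamma> z" and t: "0 \<le> t" for z t
  proof -
    \<comment> \<open>The factors \<open>\<gamma> (z t)\<close> cancel in the chain rule, leaving
      \<open>m t - m t\<close>. Every solution therefore satisfies
      \<open>\<Phi> (z t) = M t\<close>, which \<open>G\<close> inverts.\<close>
    have "((\<lambda>t. \<Phi> (z t) - M t) has_real_derivative 0) (at t within {0..})" if "t \<in> {0..}" for t
    proof -
      have dz: "(z has_real_derivative m t * \<gamma> (z t)) (at t within {0..})" and "0 \<le> z t"
        using z that by (auto simp: cauchy_solution_def)
      then show ?thesis
        using DERIV_chain2[OF d\<Phi> dz] has_field_derivative_at_within[OF dM[of t], of "{0..}"] that pos[of "z t"]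
        by (auto intro!: derivative_eq_intros)
    qed
    then obtain c where c: "\<And>t. t \<in> {0..} \<Longrightarrow> \<Phi> (z t) - M t = c"
      using has_field_derivative_zero_constant[of "{0..}" "\<lambda>t. \<Phi> (z t) - M t"] by auto
    have "z 0 = 0"
      using z by (simp add: cauchy_solution_def)
    then have "\<Phi> (z t) = M t"
      using c[of 0] c[of t] t M0 \<Phi>0 by simp
    then show ?thesis
      using G\<Phi>[of "z t"] by (simp add: y_def)
  qed
  ultimately show thesis
    using that by blast
qed

text \<open>The majorant \<open>h\<close> does not depend on \<open>t\<close>. Measurability and
  domination by \<open>h\<close> give integrability; dominated convergence on a common interval
  gives continuity, although both the kernel and the upper limit vary with \<open>t\<close>.\<close>

lemma volterra_operator:
  fixes K :: "real \<Rightarrow> real \<Rightarrow> real \<Rightarrow> real" and u h :: "real \<Rightarrow> real"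
  assumes K_cont: "continuous_on kernel_domain (\<lambda>(t, s, x). K t s x)"
    and u: "continuous_on {0..} u" and h: "continuous_on {0..} h"
    and h_nonneg: "\<And>s. 0 \<le> s \<Longrightarrow> 0 \<le> h s"
    and bound: "\<And>t s. 0 < s \<Longrightarrow> s < t \<Longrightarrow> \<bar>K t s (u s)\<bar> \<le> h s"
  shows volterra_integrable: "0 \<le> t \<Longrightarrow> (\<lambda>s. K t s (u s)) integrable_on {0..t}"
    and volterra_continuous: "continuous_on {0..} (\<lambda>t. integral {0..t} (\<lambda>s. K t s (u s)))"
proof -
  have h_int: "h integrable_on {0..t}" for t
    by (rule integrable_continuous_real) (rule continuous_on_subset[OF h], auto)
  show int: "(\<lambda>s. K t s (u s)) integrable_on {0..t}" for t
  proof -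
    have "continuous_on {0<..<t} u"
      by (rule continuous_on_subset[OF u]) auto
    then have "continuous_on {0<..<t} (\<lambda>s. (t, s, u s))"
      by (intro continuous_on_Pair continuous_on_const continuous_on_id)
    then have "continuous_on {0<..<t} (\<lambda>s. (\<lambda>(t, s, x). K t s x) (t, s, u s))"
      by (rule continuous_on_compose2[OF K_cont]) (auto simp: kernel_domain_def)
    then have "(\<lambda>s. K t s (u s)) \<in> borel_measurable (lebesgue_on {0<..<t})"
      by (simp add: continuous_imp_measurable_on_sets_lebesgue)
    then have "(\<lambda>s. K t s (u s)) integrable_on {0<..<t}"
      by (rule measurable_bounded_by_integrable_imp_integrable[where g = h])
         (use h_int[of t] bound in \<open>simp_all add: integrable_on_open_interval_real\<close>)
    then show ?thesis
      by (simp add: integrable_on_open_interval_real)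
  qed
  show "continuous_on {0..} (\<lambda>t. integral {0..t} (\<lambda>s. K t s (u s)))"
  proof (rule continuous_on_sequentiallyI)
    fix a l assume a: "\<forall>n. a n \<in> {0..}" and l: "l \<in> {0..}" and lim: "a \<longlonglongrightarrow> (l::real)"
    obtain T where T: "\<And>n. a n \<le> T"
      using convergent_imp_Bseq[of a] lim by (auto simp: convergent_def Bseq_def abs_le_iff)
    have lT: "l \<le> T"
      using lim T by (intro LIMSEQ_le_const2) auto
    \<comment> \<open>Extension by zero moves all integrals to \<open>{0..T}\<close>. The point
      \<open>s = l\<close> is removed because \<open>a n\<close> may approach \<open>l\<close> from
      above, where the values \<open>K (a n) l (u l)\<close> need not converge; finitely many points
      do not affect the integral.\<close>
    define f where "f c s = (if 0 < s \<and> s < c \<and> s \<noteq> l then K c s (u s) else 0)" for c s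
    have f: "(f c has_integral integral {0..c} (\<lambda>s. K c s (u s))) {0..T}" if "0 \<le> c" "c \<le> T" for c
    proof -
      have "((\<lambda>s. if s \<in> cbox 0 c then K c s (u s) else 0) has_integral
          integral {0..c} (\<lambda>s. K c s (u s))) (cbox 0 T)"
        using int[of c] that by (intro has_integral_restrict_closed_subinterval) auto
      then show ?thesis
        by (intro has_integral_spike_finite[where S = "{0, c, l}" and g = "f c"]) (auto simp: f_def)
    qed
    have "(\<lambda>n. integral {0..T} (f (a n))) \<longlonglongrightarrow> integral {0..T} (f l)"
    proof (rule dominated_convergence)
      show "f (a n) integrable_on {0..T}" for n
        using f[of "a n"] a T by auto
      show "h integrable_on {0..T}" by (rule h_int)
      show "norm (f (a n) s) \<le> h s" if "s \<in> {0..T}" for n s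
        using bound[of s "a n"] h_nonneg[of s] that by (auto simp: f_def)
      show "(\<lambda>n. f (a n) s) \<longlonglongrightarrow> f l s" if s: "s \<in> {0..T}" for s
      proof -
        consider "s = 0 \<or> s = l" | "l < s" | "0 < s" "s < l"
          using s by fastforce
        then show ?thesis
        proof cases
          case 1
          then show ?thesis by (auto simp: f_def)
        next
          case 2
          have "\<forall>\<^sub>F n in sequentially. f (a n) s = f l s"
            using order_tendstoD(2)[OF lim 2] by eventually_elim (use 2 in \<open>auto simp: f_def\<close>)
          then show ?thesis by (rule tendsto_eventually)
        next
          case 3
          \<comment> \<open>Continuity of the kernel is available only inside
            \<open>kernel_domain\<close>, which contains \<open>(a n, s, u s)\<close> once
            \<open>s < a n\<close>.\<close>
          have ev: "\<forall>\<^sub>F n in sequentially. s < a n"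
            by (rule order_tendstoD(1)[OF lim 3(2)])
          have "(\<lambda>n. (\<lambda>(t, s, x). K t s x) (a n, s, u s)) \<longlonglongrightarrow> (\<lambda>(t, s, x). K t s x) (l, s, u s)"
            using 3 by (intro continuous_on_tendsto_compose[OF K_cont] tendsto_intros lim)
              (auto simp: kernel_domain_def intro: eventually_mono[OF ev])
          then have "(\<lambda>n. K (a n) s (u s)) \<longlonglongrightarrow> f l s"
            using 3 by (simp add: f_def)
          then show ?thesis
            by (rule Lim_transform_eventually)
               (use ev 3 in \<open>auto simp: f_def elim!: eventually_mono\<close>)
        qed
      qed
    qed
    then show "(\<lambda>n. integral {0..a n} (\<lambda>s. K (a n) s (u s))) \<longlonglongrightarrow> integral {0..l} (\<lambda>s. K l s (u s))"
      using integral_unique[OF f] a l T lT by simp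
  qed
qed

text \<open>Secant slopes of a convex function from \<open>a\<close> increase with the other end
  point, so their limit at \<open>a\<close> is at most the slope over a unit step. This bounds
  \<open>\<gamma>'\<close> by values of \<open>\<gamma>\<close> alone.\<close>

lemma convex_on_deriv_le_increment:
  fixes f :: "real \<Rightarrow> real"
  assumes convex: "convex_on {0..} f" and d: "(f has_real_derivative d) (at a within {0..})" and a: "0 \<le> a"
  shows "d \<le> f (a + 1) - f a"
proof -
  have "((\<lambda>z. (f z - f a) / (z - a)) \<longlongrightarrow> d) (at a within {0..})"
    using d by (simp add: has_field_derivative_iff)
  then have "((\<lambda>z. (f z - f a) / (z - a)) \<longlongrightarrow> d) (at_right a)"
    by (rule tendsto_within_subset) (use a in auto)
  moreover have "\<forall>\<^sub>F z in at_right a. (f z - f a) / (z - a) \<le> f (a + 1) - f a"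
  proof -
    have "\<forall>\<^sub>F z in at_right a. z \<in> {a<..<a + 1}"
      by (rule eventually_at_rightI[of a "a + 1"]) auto
    then show ?thesis
    proof eventually_elim
      case (elim z)
      \<comment> \<open>The point \<open>z\<close> is the convex combination of \<open>a\<close> and
        \<open>a + 1\<close> with weight \<open>z - a\<close>.\<close>
      have "f ((1 - (z - a)) *\<^sub>R a + (z - a) *\<^sub>R (a + 1)) \<le> (1 - (z - a)) * f a + (z - a) * f (a + 1)"
        using elim a by (intro convex_onD[OF convex]) auto
      then have "f z \<le> (1 - (z - a)) * f a + (z - a) * f (a + 1)"
        by (simp add: algebra_simps)
      then show ?case
        using elim by (subst pos_divide_le_eq) (auto simp: algebra_simps)
    qed
  qed
  ultimately show ?thesis
    by (intro tendsto_upperbound) auto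
qed

text \<open>Continuity is local, and \<open>{a..t + 1}\<close> is a neighbourhood of
  \<open>t\<close> relative to \<open>{a..}\<close>. Uniform limits on bounded intervals thus yield
  continuity on the half-line.\<close>

lemma continuous_on_atLeast_if_Icc:
  fixes f :: "real \<Rightarrow> 'a::topological_space"
  assumes "\<And>T. continuous_on {a..T} f"
  shows "continuous_on {a..} f"
  unfolding continuous_on_def
proof
  fix t assume "t \<in> {a..}"
  then have "(f \<longlongrightarrow> f t) (at t within {a..t + 1})"
    using assms[of "t + 1"] by (simp add: continuous_on_def)
  moreover have "at t within {a..t + 1} = at t within {a..}"
    by (rule at_within_nhd[of _ "{..<t + 1}"]) auto
  ultimately show "(f \<longlongrightarrow> f t) (at t within {a..})"
    by simp
qed

text \<open>This is the inductive step of the exponential estimate: integrating \<open>L\<close>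
  times one term of the series produces the next term.\<close>

lemma has_integral_exp_term:
  fixes C L t :: real
  assumes "0 \<le> t"
  shows "((\<lambda>s. L * (C * (L * s) ^ n / fact n)) has_integral C * (L * t) ^ Suc n / fact (Suc n)) {0..t}"
proof -
  have "((\<lambda>s. C * (L * s) ^ Suc n / fact (Suc n)) has_real_derivative L * (C * (L * s) ^ n / fact n)) (at s within {0..t})"
    for s
  proof -
    have "((\<lambda>s. C * (L * s) ^ Suc n / fact (Suc n)) has_real_derivative
        C * (real (Suc n) * (L * s) ^ n * L) / fact (Suc n)) (at s within {0..t})"
      by (rule derivative_eq_intros refl | simp)+
    also have "C * (real (Suc n) * (L * s) ^ n * L) / fact (Suc n) = L * (C * (L * s) ^ n / fact n)"
      by (simp only: fact_Suc) simp
    finally show ?thesis .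
  qed
  then have "((\<lambda>s. L * (C * (L * s) ^ n / fact n)) has_integral
      C * (L * t) ^ Suc n / fact (Suc n) - C * (L * 0) ^ Suc n / fact (Suc n)) {0..t}"
    using assms
    by (intro fundamental_theorem_of_calculus)
       (simp_all only: has_real_derivative_iff_has_vector_derivative)
  then show ?thesis by simp
qed

theorem theorem1:
  fixes K Kx :: "real \<Rightarrow> real \<Rightarrow> real \<Rightarrow> real"
    and m \<gamma> \<gamma>' :: "real \<Rightarrow> real"
  assumes K_cont: "continuous_on kernel_domain (\<lambda>(t, s, x). K t s x)"
    and K_deriv: "\<And>t s x. (t, s, x) \<in> kernel_domain \<Longrightarrow>
      ((\<lambda>z. K t s z) has_real_derivative Kx t s x) (at x)"
    and m: "increasing_factor m"
    and \<gamma>: "increasing_factor \<gamma>"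
    and \<gamma>_deriv: "\<And>x. 0 \<le> x \<Longrightarrow> (\<gamma> has_real_derivative \<gamma>' x) (at x within {0..})"
    and \<gamma>_convex: "convex_on {0..} \<gamma>"
    and \<gamma>_0: "\<gamma> 0 \<noteq> 0"
    and K_bound: "\<And>t s x. (t, s, x) \<in> kernel_domain \<Longrightarrow> \<bar>K t s x\<bar> \<le> m s * \<gamma> \<bar>x\<bar>"
    and Kx_bound: "\<And>t s x. (t, s, x) \<in> kernel_domain \<Longrightarrow> \<bar>Kx t s x\<bar> \<le> m s * \<gamma>' \<bar>x\<bar>"
    and diverges: "filterlim (\<lambda>x. integral {0..x} (\<lambda>\<xi>. 1 / \<gamma> \<xi>)) at_top at_top"
  shows "\<exists>x y. kantorovich_main_solution K {0..} x \<and> x 0 = 0 \<and>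
    cauchy_solution m \<gamma> y \<and>
    (\<forall>z. cauchy_solution m \<gamma> z \<longrightarrow> (\<forall>t\<ge>0. z t = y t)) \<and>
    (\<forall>t\<ge>0. \<bar>x t\<bar> \<le> y t)"
proof -

  \<comment> \<open>The majorant and the bound it gives on the kernel\<close>
  obtain y where y: "cauchy_solution m \<gamma> y"
    and y_unique: "\<And>z t. cauchy_solution m \<gamma> z \<Longrightarrow> 0 \<le> t \<Longrightarrow> z t = y t"
    using cauchy_solution_unique_existence[OF m \<gamma> \<gamma>_0 diverges] by blast
  have y0: "y 0 = 0" and y_nonneg: "\<And>t. 0 \<le> t \<Longrightarrow> 0 \<le> y t"
    using y by (auto simp: cauchy_solution_def)
  have y_cont: "continuous_on {0..} y"
    using y by (intro DERIV_continuous_on) (auto simp: cauchy_solution_def)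
  note m_nonneg = increasing_factor_nonneg[OF m] and \<gamma>_nonneg = increasing_factor_nonneg[OF \<gamma>]
    and m_mono = mono_onD[OF increasing_factor_mono_on[OF m]]
    and \<gamma>_mono = mono_onD[OF increasing_factor_mono_on[OF \<gamma>]]
  \<comment> \<open>\<open>h\<close> is the derivative of the majorant, so its integral over
    \<open>{0..t}\<close> is exactly \<open>y t\<close>. The integral operator therefore maps
    continuous functions bounded by \<open>y\<close> to functions bounded by
    \<open>y\<close>.\<close>
  define h where "h s = m s * \<gamma> (y s)" for s
  have h_nonneg: "0 \<le> h s" if "0 \<le> s" for s
    using that by (simp add: h_def m_nonneg \<gamma>_nonneg y_nonneg)
  have h_cont: "continuous_on {0..} h"
    unfolding h_def
    by (rule continuous_on_mult[OF increasing_factor_continuous_on[OF m]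
          continuous_on_compose2[OF increasing_factor_continuous_on[OF \<gamma>] y_cont]])
       (use y_nonneg in auto)
  have h_int: "(h has_integral y t) {0..t}" if "0 \<le> t" for t
    using cauchy_solution_has_integral[OF y that] by (simp add: h_def[abs_def])
  have y_mono: "y s \<le> y t" if "0 \<le> s" "s \<le> t" for s t
    using that h_nonneg by (intro has_integral_subset_le[OF _ h_int h_int]) auto
  have K_h: "\<bar>K t s a\<bar> \<le> h s" if "0 < s" "s < t" "\<bar>a\<bar> \<le> y s" for t s a
  proof -
    have "\<bar>K t s a\<bar> \<le> m s * \<gamma> \<bar>a\<bar>"
      using that by (intro K_bound) (simp add: kernel_domain_def)
    also have "\<dots> \<le> h s"
      unfolding h_def using that by (intro mult_left_mono \<gamma>_mono m_nonneg) auto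
    finally show ?thesis .
  qed
  have K_int: "(\<lambda>s. K t s (u s)) integrable_on {0..t}"
    if "continuous_on {0..} u" "\<And>s. 0 \<le> s \<Longrightarrow> \<bar>u s\<bar> \<le> y s" "0 \<le> t" for u t
    by (rule volterra_integrable[OF K_cont that(1) h_cont h_nonneg])
       (use that K_h in auto)

  \<comment> \<open>Picard iterates below the majorant\<close>
  define p where "p = picard K"
  \<comment> \<open>The open interval keeps the integrand inside \<open>kernel_domain\<close>;
    nothing is assumed about \<open>K\<close> at \<open>s = 0\<close> and
    \<open>s = t\<close>.\<close>
  have p_Suc: "p (Suc n) t = integral {0<..<t} (\<lambda>s. K t s (p n s))" for n t
    by (simp add: p_def integral_open_interval_real)
  have p: "continuous_on {0..} (p n) \<and> (\<forall>t\<ge>0. \<bar>p n t\<bar> \<le> y t)" for n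
  proof (induction n)
    case 0
    then show ?case by (simp add: p_def y_nonneg)
  next
    case (Suc n)
    have "continuous_on {0..} (p (Suc n))"
      using volterra_continuous[OF K_cont _ h_cont h_nonneg, of "p n"] Suc K_h
      by (simp add: p_def)
    moreover have "\<bar>p (Suc n) t\<bar> \<le> y t" if "0 \<le> t" for t
    proof -
      have "norm (p (Suc n) t) \<le> integral {0<..<t} h"
        unfolding p_Suc using K_int[of "p n" t] Suc K_h h_int[OF that] that
        by (intro integral_norm_bound_integral)
           (auto simp: integrable_on_open_interval_real)
      also have "\<dots> = y t"
        using h_int[OF that] by (simp add: integral_open_interval_real[symmetric] integral_unique)
      finally show ?thesis by simp
    qed
    ultimately show ?case by blast
  qed
  then have p_cont: "\<And>n. continuous_on {0..} (p n)" and p_le: "\<And>n t. 0 \<le> t \<Longrightarrow> \<bar>p n t\<bar> \<le> y t"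
    by auto
  have p_int: "(\<lambda>s. K t s (p n s)) integrable_on {0<..<t}" if "0 \<le> t" for n t
    using K_int[OF p_cont p_le that] by (simp add: integrable_on_open_interval_real)

  \<comment> \<open>Lipschitz constant and exponential estimate of differences\<close>
  define L where "L T = m T * \<gamma> (y T + 1)" for T
  have L_nonneg: "0 \<le> L T" if "0 \<le> T" for T
    using that y_nonneg[OF that] by (simp add: L_def m_nonneg \<gamma>_nonneg)
  have lipschitz: "\<bar>K t s a - K t s b\<bar> \<le> L T * \<bar>a - b\<bar>"
    if "0 < s" "s < t" "t \<le> T" "\<bar>a\<bar> \<le> y T" "\<bar>b\<bar> \<le> y T" for t s T a b
  proof -
    have dom: "(t, s, z) \<in> kernel_domain" for z
      using that by (simp add: kernel_domain_def)
    \<comment> \<open>Mean value inequality on the convex set \<open>{- y T..y T}\<close>: there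
      \<open>\<gamma>'\<close> is controlled by the unit-step chord, and \<open>s < T\<close>
      replaces \<open>m s\<close> by \<open>m T\<close>.\<close>
    have "norm (K t s a - K t s b) \<le> L T * norm (a - b)"
    proof (rule field_differentiable_bound[where S = "{- y T..y T}" and f' = "Kx t s"])
      fix z assume z: "z \<in> {- y T..y T}"
      show "(K t s has_real_derivative Kx t s z) (at z within {- y T..y T})"
        by (rule has_field_derivative_at_within[OF K_deriv[OF dom]])
      have "\<gamma>' \<bar>z\<bar> \<le> \<gamma> (\<bar>z\<bar> + 1) - \<gamma> \<bar>z\<bar>"
        by (intro convex_on_deriv_le_increment[OF \<gamma>_convex] \<gamma>_deriv) auto
      also have "\<dots> \<le> \<gamma> (\<bar>z\<bar> + 1)"
        using \<gamma>_nonneg[of "\<bar>z\<bar>"] by simp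
      also have "\<dots> \<le> \<gamma> (y T + 1)"
        using z by (intro \<gamma>_mono) auto
      finally have "m s * \<gamma>' \<bar>z\<bar> \<le> m s * \<gamma> (y T + 1)"
        using that by (intro mult_left_mono m_nonneg) auto
      also have "\<dots> \<le> L T"
        unfolding L_def using that y_nonneg[of T]
        by (intro mult_right_mono m_mono \<gamma>_nonneg) auto
      finally show "norm (Kx t s z) \<le> L T"
        using Kx_bound[OF dom, of z] by simp
    qed (use that in auto)
    then show ?thesis by simp
  qed
  \<comment> \<open>\<open>T\<close> stays fixed while \<open>t\<close> varies in the induction, so
    one constant \<open>L T\<close> serves all \<open>s < t\<close>. The factor \<open>y T\<close>
    bounds the first difference, which is \<open>p (Suc 0) t\<close> because
    \<open>p 0 t = 0\<close>.\<close>
  have diff: "\<bar>p (Suc n) t - p n t\<bar> \<le> y T * (L T * t) ^ n / fact n" if "0 \<le> t" "t \<le> T" for n t T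
    using that
  proof (induction n arbitrary: t)
    case 0
    then show ?case
      using p_le[of t "Suc 0"] y_mono[of t T] by (simp add: p_def)
  next
    case (Suc n)
    let ?e = "\<lambda>s. L T * (y T * (L T * s) ^ n / fact n)"
    have e: "(?e has_integral y T * (L T * t) ^ Suc n / fact (Suc n)) {0<..<t}"
      using has_integral_exp_term[OF Suc.prems(1), of "L T" "y T" n] by (simp only: has_integral_Icc_iff_Ioo)
    have "norm (p (Suc (Suc n)) t - p (Suc n) t)
        = norm (integral {0<..<t} (\<lambda>s. K t s (p (Suc n) s) - K t s (p n s)))"
      unfolding p_Suc[of "Suc n"] p_Suc[of n t]
      using p_int[OF Suc.prems(1)] by (subst integral_diff) auto
    also have "\<dots> \<le> integral {0<..<t} ?e"
    proof (rule integral_norm_bound_integral)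
      show "(\<lambda>s. K t s (p (Suc n) s) - K t s (p n s)) integrable_on {0<..<t}"
        by (intro integrable_diff p_int Suc.prems)
      show "?e integrable_on {0<..<t}"
        using e by blast
      fix s assume s: "s \<in> {0<..<t}"
      have "\<bar>K t s (p (Suc n) s) - K t s (p n s)\<bar> \<le> L T * \<bar>p (Suc n) s - p n s\<bar>"
        using s Suc.prems y_mono[of s T] p_le[of s n] p_le[of s "Suc n"] by (intro lipschitz) auto
      also have "\<dots> \<le> ?e s"
        using s Suc.prems by (intro mult_left_mono Suc.IH L_nonneg) auto
      finally show "norm (K t s (p (Suc n) s) - K t s (p n s)) \<le> ?e s" by simp
    qed
    also have "\<dots> = y T * (L T * t) ^ Suc n / fact (Suc n)"
      using e by (rule integral_unique)
    finally show ?case by simp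
  qed

  \<comment> \<open>Uniform convergence and the limit equation\<close>
  define x where "x t = (\<Sum>i. p (Suc i) t - p i t)" for t
  have unif: "uniform_limit {0..T} p x sequentially" for T
  proof -
    have "uniform_limit {0..T} (\<lambda>n t. \<Sum>i<n. p (Suc i) t - p i t) (\<lambda>t. \<Sum>i. p (Suc i) t - p i t) sequentially"
    proof (rule Weierstrass_m_test)
      show "summable (\<lambda>n. y T * (L T * T) ^ n / fact n)"
        using summable_mult[OF summable_exp[of "L T * T"], of "y T"] by (simp add: field_simps)
      fix n t assume t: "t \<in> {0..T}"
      have "y T * (L T * t) ^ n / fact n \<le> y T * (L T * T) ^ n / fact n"
        using t by (intro divide_right_mono mult_left_mono power_mono y_nonneg)
          (auto intro!: mult_nonneg_nonneg mult_left_mono L_nonneg)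
      with diff[of t T n] t show "norm (p (Suc n) t - p n t) \<le> y T * (L T * T) ^ n / fact n"
        by simp
    qed
    \<comment> \<open>The sum telescopes and \<open>p 0 t = 0\<close>, so the partial sums of the
      series are the iterates themselves.\<close>
    moreover have "(\<Sum>i<n. p (Suc i) t - p i t) = p n t" for n t
      using sum_lessThan_telescope[of "\<lambda>i. p i t" n] by (simp add: p_def del: picard.simps(2))
    ultimately show ?thesis
      by (simp add: x_def[abs_def])
  qed
  have lim: "(\<lambda>n. p n t) \<longlonglongrightarrow> x t" if "0 \<le> t" for t
    using tendsto_uniform_limitI[OF unif[of t]] that by simp
  have x_cont: "continuous_on {0..} x"
    by (rule continuous_on_atLeast_if_Icc, rule uniform_limit_theorem[OF _ unif])
       (auto intro!: always_eventually continuous_on_subset[OF p_cont])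
  have x_le: "\<bar>x t\<bar> \<le> y t" if "0 \<le> t" for t
    using p_le[OF that] by (intro tendsto_upperbound[OF tendsto_rabs[OF lim[OF that]]]) auto
  have x_eq: "((\<lambda>s. K t s (x s)) has_integral x t) {0..t}" if t: "0 \<le> t" for t
  proof -
    \<comment> \<open>Differentiability of \<open>K\<close> in its last argument gives continuity
      there, hence pointwise convergence of the integrands. With \<open>h\<close> dominating, the
      limit passes under the integral, and the shifted sequence identifies its value as
      \<open>x t\<close>.\<close>
    have conv: "(\<lambda>n. K t s (p n s)) \<longlonglongrightarrow> K t s (x s)" if "s \<in> {0<..<t}" for s
      by (rule isCont_tendsto_compose[OF DERIV_isCont[OF K_deriv] lim])
         (use that in \<open>auto simp: kernel_domain_def\<close>)
    have h': "h integrable_on {0<..<t}"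
      using h_int[OF t] by (auto simp: integrable_on_open_interval_real)
    have bound: "norm (K t s (p n s)) \<le> h s" if "s \<in> {0<..<t}" for n s
      using that K_h[of s t "p n s"] p_le[of s n] by simp
    have "(\<lambda>n. p (Suc n) t) \<longlonglongrightarrow> integral {0<..<t} (\<lambda>s. K t s (x s))"
      unfolding p_Suc by (rule dominated_convergence(2)[OF p_int[OF t] h' bound conv])
    moreover have "(\<lambda>n. p (Suc n) t) \<longlonglongrightarrow> x t"
      using lim[OF t] by (rule LIMSEQ_Suc)
    ultimately have "integral {0<..<t} (\<lambda>s. K t s (x s)) = x t"
      by (rule LIMSEQ_unique)
    then show ?thesis
      using K_int[OF x_cont x_le t]
      by (metis integral_open_interval_real integrable_integral)
  qed
  have "kantorovich_main_solution K {0..} x"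
    unfolding kantorovich_main_solution_def
    using x_cont x_eq lim K_int[OF p_cont p_le] by (auto simp: p_def)
  moreover have "x 0 = 0"
    using x_le[of 0] y0 by simp
  ultimately show ?thesis
    using y y_unique x_le by blast
qed

end
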